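(* Let $\mathcal{C}$ be a covering of a finite set $U$ with $|U|=m$, such that there are no two distinct elements $u,v\in U$ with $\mathcal{C}(\{u\})=\mathcal{C}(\{v\})$ and $|\mathcal{C}(\{u\})|=1$. Let $V$ be an $n$-dimensional vector space over the finite field $\mathbb{F}_q$, and let $L(V)$ be the lattice of subspaces of $V$ ordered by inclusion. If $L(\mathcal{C})\cong L(V)$, then $n\leq 2$. In the case $n=2$, we must have $m=q+1$ and $k=1$, where $k:=|\mathcal{E}|$.
   Context: A covering of a finite set $U$ is a collection $\mathcal{C}\subseteq 2^U$ of subsets of $U$ whose union is $U$. For $H\subseteq U$, $\mathcal{C}(H):=\{C\in\mathcal{C} : C\cap H\neq\emptyset\}$. The matroid $M(\mathcal{C})$ is the transversal matroid of $\mathcal{C}$ on the ground set $U$: its independent sets are the partial transversals of $\mathcal{C}$, i.e. the sets $I\subseteq U$ for which there is an injective map $\varphi:I\to\mathcal{C}$ with $e\in\varphi(e)$ for all $e\in I$. $L(\mathcal{C})$ is the lattice of closed sets (flats) of $M(\mathcal{C})$ ordered by inclusion. For $x\in U$ with $|\mathcal{C}(\{x\})|=2$, $E(\{x\}):=\{y\in U : \mathcal{C}(\{y\})\subseteq\mathcal{C}(\{x\})\}$, and $\mathcal{E}:=\{E(\{x\}) : x\in U,\ |\mathcal{C}(\{x\})|=2\}$. *)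

theory Defs
  imports Complex_Main "HOL-Library.Cardinality"
begin

definition covering :: "'a set \<Rightarrow> 'a set set \<Rightarrow> bool" where
  "covering U \<C> \<longleftrightarrow> \<C> \<subseteq> Pow U \<and> \<Union>\<C> = U"

definition meeting :: "'a set set \<Rightarrow> 'a set \<Rightarrow> 'a set set" where
  "meeting \<C> H = {C \<in> \<C>. C \<inter> H \<noteq> {}}"

definition partial_transversal :: "'a set \<Rightarrow> 'a set set \<Rightarrow> 'a set \<Rightarrow> bool" where
  "partial_transversal U \<C> I \<longleftrightarrow>
     I \<subseteq> U \<and> (\<exists>\<phi>. inj_on \<phi> I \<and> (\<forall>e\<in>I. \<phi> e \<in> \<C> \<and> e \<in> \<phi> e))"

text \<open>A matroid on a finite ground set \<open>U\<close> is represented by its independence predicate;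
  rank, closure and flats are the usual ones. The rank is meant for subsets \<open>X\<close> of \<open>U\<close>, for which
  the maximum ranges over a finite set that is nonempty since the empty set is independent.\<close>

definition matroid_rank :: "('a set \<Rightarrow> bool) \<Rightarrow> 'a set \<Rightarrow> nat" where
  "matroid_rank indep X = Max {card I | I. I \<subseteq> X \<and> indep I}"

definition matroid_closure :: "'a set \<Rightarrow> ('a set \<Rightarrow> bool) \<Rightarrow> 'a set \<Rightarrow> 'a set" where
  "matroid_closure U indep X = {x \<in> U. matroid_rank indep (insert x X) = matroid_rank indep X}"

definition matroid_flats :: "'a set \<Rightarrow> ('a set \<Rightarrow> bool) \<Rightarrow> 'a set set" where
  "matroid_flats U indep = {F. F \<subseteq> U \<and> matroid_closure U indep F = F}"

definition covering_lattice :: "'a set \<Rightarrow> 'a set set \<Rightarrow> 'a set set" where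
  "covering_lattice U \<C> = matroid_flats U (partial_transversal U \<C>)"

definition subspace_lattice :: "('k::field \<Rightarrow> 'v::ab_group_add \<Rightarrow> 'v) \<Rightarrow> 'v set set" where
  "subspace_lattice scale = {S. module.subspace scale S}"

text \<open>Isomorphism of families of sets ordered by inclusion. An order isomorphism
  between lattices is the same as a lattice isomorphism.\<close>

definition inclusion_isomorphic :: "'a set set \<Rightarrow> 'b set set \<Rightarrow> bool" where
  "inclusion_isomorphic \<A> \<B> \<longleftrightarrow>
     (\<exists>f. bij_betw f \<A> \<B> \<and> (\<forall>X\<in>\<A>. \<forall>Y\<in>\<A>. X \<subseteq> Y \<longleftrightarrow> f X \<subseteq> f Y))"

definition E_set :: "'a set \<Rightarrow> 'a set set \<Rightarrow> 'a \<Rightarrow> 'a set" where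
  "E_set U \<C> x = {y \<in> U. meeting \<C> {y} \<subseteq> meeting \<C> {x}}"

definition E_family :: "'a set \<Rightarrow> 'a set set \<Rightarrow> 'a set set" where
  "E_family U \<C> = {E_set U \<C> x | x. x \<in> U \<and> card (meeting \<C> {x}) = 2}"

end

theory Submission
  imports Defs
begin

text \<open>The covering hypothesis makes \<open>M(\<C>)\<close> a simple matroid, so an isomorphism \<open>L(\<C>) \<cong> L(V)\<close> matches the
  elements of \<open>U\<close> with the lines through the origin of \<open>V\<close>, that is with the points of the projective
  space of \<open>V\<close>. By Hall's condition, among three collinear points there is one, \<open>t\<close>, that lies in exactly
  two members of the covering, while the other two points lie in no further members. Thus \<open>\<C>({t})\<close>
  determines the projective line, so that \<open>t\<close> lies on a single line with at least three points. Every
  projective line has at least three points, so all points lie on one line and \<open>n \<le> 2\<close>. If \<open>n = 2\<close>,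
  there are \<open>q + 1\<close> points, and \<open>E({t}) = U\<close> for every such \<open>t\<close>.\<close>

section \<open>Rank and flats\<close>

lemma card_le_matroid_rank:
  assumes "finite X" "I \<subseteq> X" "indep I"
  shows "card I \<le> matroid_rank indep X"
  unfolding matroid_rank_def using assms by (intro Max_ge) auto

lemma matroid_rank_leI:
  assumes "finite X" "indep {}" "\<And>I. I \<subseteq> X \<Longrightarrow> indep I \<Longrightarrow> card I \<le> r"
  shows "matroid_rank indep X \<le> r"
  unfolding matroid_rank_def using assms by (subst Max_le_iff) auto

lemma matroid_rank_le_card:
  assumes "finite X" "indep {}"
  shows "matroid_rank indep X \<le> card X"
  using assms by (intro matroid_rank_leI) (auto intro: card_mono)

lemma matroid_rank_mono:
  assumes "finite Y" "X \<subseteq> Y" "indep {}"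
  shows "matroid_rank indep X \<le> matroid_rank indep Y"
  using assms by (intro matroid_rank_leI) (auto intro: card_le_matroid_rank finite_subset)

text \<open>The rank of \<open>X\<close> is at most \<open>card X\<close>, and \<open>F\<close>
  contains an independent set with one element more.\<close>

lemma less_matroid_rank:
  assumes "finite F" "indep {}" "insert z X \<subseteq> F" "z \<notin> X" "indep (insert z X)"
  shows "matroid_rank indep X < matroid_rank indep F"
proof -
  have fin: "finite X" using assms(1,3) finite_subset[of X F] by simp
  have "matroid_rank indep X < card (insert z X)"
    using matroid_rank_le_card[of X indep, OF fin assms(2)] fin assms(4) by simp
  also have "\<dots> \<le> matroid_rank indep F"
    using assms by (intro card_le_matroid_rank)
  finally show ?thesis .
qed

text \<open>Each outside element raises the rank, so the closure adds nothing. This serves for the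
  empty set and for singletons.\<close>

lemma flatI:
  assumes "finite U" "indep {}" "X \<subseteq> U" "\<And>z. z \<in> U - X \<Longrightarrow> indep (insert z X)"
  shows "X \<in> matroid_flats U indep"
proof -
  have "finite X" using assms(1,3) by (rule rev_finite_subset)
  then have "matroid_rank indep (insert z X) \<noteq> matroid_rank indep X" if "z \<in> U - X" for z
    using less_matroid_rank[of "insert z X" indep z X] that assms(2,4) by auto
  then show ?thesis
    using assms(3) unfolding matroid_flats_def matroid_closure_def by (auto simp: insert_absorb)
qed

text \<open>The flat is a maximal superset of \<open>X\<close> of the same rank: maximality makes it
  closed, and a member \<open>z\<close> would raise its rank.\<close>

lemma flat_separates_indep:
  assumes "finite U" "indep {}" "insert z X \<subseteq> U" "z \<notin> X" "indep (insert z X)"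
  obtains F where "F \<in> matroid_flats U indep" "X \<subseteq> F" "z \<notin> F"
proof -
  let ?P = "\<lambda>F. X \<subseteq> F \<and> F \<subseteq> U \<and> matroid_rank indep F = matroid_rank indep X"
  have "finite (Collect ?P)" using assms(1) by (auto intro: finite_subset[of _ "Pow U"])
  moreover have "Collect ?P \<noteq> {}" using assms by auto
  ultimately have "\<exists>F\<in>Collect ?P. \<forall>G\<in>Collect ?P. F \<subseteq> G \<longrightarrow> F = G" by (rule finite_has_maximal)
  then obtain F where F: "?P F" and max: "\<And>G. ?P G \<Longrightarrow> F \<subseteq> G \<Longrightarrow> F = G"
    by auto
  have "finite F" using F assms(1) by (auto intro: rev_finite_subset)
  then have "z \<notin> F"
    using less_matroid_rank[of F indep z X] F assms(2,4,5) by auto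
  moreover have "w \<in> F"
    if "w \<in> U" "matroid_rank indep (insert w F) = matroid_rank indep F" for w
    using max[of "insert w F"] F that by auto
  then have "F \<in> matroid_flats U indep"
    using F unfolding matroid_flats_def matroid_closure_def by (auto simp: insert_absorb)
  ultimately show ?thesis using that[of F] F by simp
qed

section \<open>Simple coverings\<close>

lemma meeting_singleton: "meeting \<C> {x} = {C \<in> \<C>. x \<in> C}"
  by (auto simp: meeting_def)

lemma partial_transversal_empty: "partial_transversal U \<C> {}"
  by (simp add: partial_transversal_def)

lemma partial_transversal_singleton:
  assumes "covering U \<C>" "x \<in> U"
  shows "partial_transversal U \<C> {x}"
  using assms by (fastforce simp: partial_transversal_def covering_def)

lemma partial_transversal_pair:
  assumes "{x, y} \<subseteq> U" "A \<in> meeting \<C> {x}" "B \<in> meeting \<C> {y}" "A \<noteq> B"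
  shows "partial_transversal U \<C> {x, y}"
  unfolding partial_transversal_def
  using assms
  by (intro conjI exI[of _ "\<lambda>e. if e = x then A else B"])
     (auto simp: inj_on_def meeting_singleton)

lemma partial_transversal_triple:
  assumes "{x, y, z} \<subseteq> U"
    "A \<in> meeting \<C> {x}" "B \<in> meeting \<C> {y}" "C \<in> meeting \<C> {z}" "A \<noteq> B" "A \<noteq> C" "B \<noteq> C"
  shows "partial_transversal U \<C> {x, y, z}"
  unfolding partial_transversal_def
  using assms
  by (intro conjI exI[of _ "\<lambda>e. if e = x then A else if e = y then B else C"])
     (auto simp: inj_on_def meeting_singleton)

locale simple_covering =
  fixes U :: "'a set" and \<C> :: "'a set set"
  assumes finite_ground: "finite U"
    and covering: "covering U \<C>"
    and simple: "\<And>u v. u \<in> U \<Longrightarrow> v \<in> U \<Longrightarrow> meeting \<C> {u} = meeting \<C> {v} \<Longrightarrow>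
                   card (meeting \<C> {u}) = 1 \<Longrightarrow> u = v"
begin

lemma finite_meeting: "finite (meeting \<C> H)"
proof -
  have "finite \<C>"
    using finite_ground covering unfolding covering_def by (meson finite_Pow_iff finite_subset)
  then show ?thesis by (simp add: meeting_def)
qed

lemma meeting_nonempty: "x \<in> U \<Longrightarrow> meeting \<C> {x} \<noteq> {}"
  using covering by (auto simp: covering_def meeting_singleton)

section \<open>Absence of loops and parallel elements\<close>

text \<open>Hall's condition for two elements: it fails only if both lie in one and the same single
  member, which \<open>simple\<close> excludes.\<close>

lemma distinct_representatives:
  assumes "x \<in> U" "y \<in> U" "x \<noteq> y"
  obtains A B where "A \<in> meeting \<C> {x}" "B \<in> meeting \<C> {y}" "A \<noteq> B"
proof (rule ccontr)
  assume "\<not> thesis"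
  then have eq: "A = B" if "A \<in> meeting \<C> {x}" "B \<in> meeting \<C> {y}" for A B
    using that \<open>\<And>B A. A \<in> meeting \<C> {x} \<Longrightarrow> B \<in> meeting \<C> {y} \<Longrightarrow> A \<noteq> B \<Longrightarrow> thesis\<close> by blast
  obtain A where A: "A \<in> meeting \<C> {x}" using meeting_nonempty assms by blast
  have "meeting \<C> {y} = {A}" using eq A meeting_nonempty[OF assms(2)] by blast
  moreover from this have "meeting \<C> {x} = {A}" using eq A by blast
  ultimately show False using simple[of x y] assms by simp
qed

lemma partial_transversal_pairI:
  assumes "x \<in> U" "y \<in> U"
  shows "partial_transversal U \<C> {x, y}"
proof (cases "x = y")
  case True
  then show ?thesis using partial_transversal_singleton covering assms by simp
next
  case False
  with assms distinct_representatives[of x y] show ?thesis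
    by (metis partial_transversal_pair bot.extremum insert_subset)
qed

lemma empty_flat: "{} \<in> covering_lattice U \<C>"
  unfolding covering_lattice_def
  by (rule flatI) (auto simp: finite_ground partial_transversal_empty
      intro: partial_transversal_singleton covering)

text \<open>As no two elements are parallel, the singletons are the atoms of the lattice; they will
  be matched with the one-dimensional subspaces.\<close>

lemma singleton_flat: "x \<in> U \<Longrightarrow> {x} \<in> covering_lattice U \<C>"
  unfolding covering_lattice_def
  by (rule flatI) (auto simp: finite_ground partial_transversal_empty
      intro: partial_transversal_pairI)

section \<open>Dependent triples\<close>

text \<open>Fix distinct representatives \<open>A\<close> of \<open>y\<close> and \<open>B\<close>
  of \<open>z\<close>. A third member through \<open>x\<close> would complete a transversal, so
  \<open>x\<close> lies in \<open>A\<close> and \<open>B\<close> only.\<close>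

lemma dependent_triple_large_point:
  assumes U: "{x, y, z} \<subseteq> U" and neq: "y \<noteq> z"
    and dep: "\<not> partial_transversal U \<C> {x, y, z}"
    and large: "card (meeting \<C> {x}) \<noteq> 1"
  shows "card (meeting \<C> {x}) = 2 \<and> meeting \<C> {y} \<subseteq> meeting \<C> {x} \<and> meeting \<C> {z} \<subseteq> meeting \<C> {x}"
proof -
  obtain A B where AB: "A \<in> meeting \<C> {y}" "B \<in> meeting \<C> {z}" "A \<noteq> B"
    using distinct_representatives[of y z] U neq by blast
  have sub: "meeting \<C> {x} \<subseteq> {A, B}"
    using partial_transversal_triple[of x y z U _ \<C> A B] U AB dep by blast
  have "meeting \<C> {x} \<noteq> {D}" for D using large by auto
  moreover have "meeting \<C> {x} \<noteq> {}" using meeting_nonempty U by simp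
  ultimately have eq: "meeting \<C> {x} = {A, B}" using sub by blast
  \<comment> \<open>Otherwise \<open>y\<close> could switch to \<open>D\<close>, leaving
    \<open>A\<close> to \<open>x\<close>; the case of \<open>z\<close> is symmetric.\<close>
  have "D \<in> {A, B}" if "D \<in> meeting \<C> {y}" for D
    using partial_transversal_triple[of x y z U A \<C> D B] U AB dep eq that by blast
  moreover have "D \<in> {A, B}" if "D \<in> meeting \<C> {z}" for D
    using partial_transversal_triple[of x y z U B \<C> A D] U AB dep eq that by blast
  ultimately show ?thesis using eq AB(3) by auto
qed

text \<open>If each of the three lay in a single member, \<open>simple\<close> would make these
  members distinct and the triple independent. So one of them lies in several members and can play
  the large point.\<close>

lemma dependent_triple:
  assumes "{x, y, z} \<subseteq> U" "x \<noteq> y" "x \<noteq> z" "y \<noteq> z" "\<not> partial_transversal U \<C> {x, y, z}"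
  obtains t where "t \<in> {x, y, z}" "card (meeting \<C> {t}) = 2"
    "\<And>s. s \<in> {x, y, z} \<Longrightarrow> meeting \<C> {s} \<subseteq> meeting \<C> {t}"
proof -
  have "\<exists>t\<in>{x, y, z}. card (meeting \<C> {t}) \<noteq> 1"
  proof (rule ccontr)
    assume "\<not> ?thesis"
    then have c: "card (meeting \<C> {x}) = 1" "card (meeting \<C> {y}) = 1" "card (meeting \<C> {z}) = 1"
      by auto
    then obtain A B D where ABD: "meeting \<C> {x} = {A}" "meeting \<C> {y} = {B}" "meeting \<C> {z} = {D}"
      by (meson card_1_singletonE)
    then have "A \<noteq> B" "A \<noteq> D" "B \<noteq> D"
      using assms(1-4) simple[of x y] simple[of x z] simple[of y z] by auto
    then show False
      using partial_transversal_triple[of x y z U A \<C> B D] assms ABD by simp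
  qed
  then consider "card (meeting \<C> {x}) \<noteq> 1" | "card (meeting \<C> {y}) \<noteq> 1" | "card (meeting \<C> {z}) \<noteq> 1"
    by blast
  then show ?thesis
  proof cases
    case 1
    from dependent_triple_large_point[of x y z] 1 assms that[of x] show ?thesis by blast
  next
    case 2
    from dependent_triple_large_point[of y x z] 2 assms that[of y] show ?thesis
      by (auto simp: insert_commute)
  next
    case 3
    from dependent_triple_large_point[of z x y] 3 assms that[of z] show ?thesis
      by (auto simp: insert_commute)
  qed
qed

text \<open>Reads dependence off the lattice alone, so that it can be transported from
  \<open>V\<close>: were the triple independent, \<open>flat_separates_indep\<close> would give a
  flat through \<open>x\<close> and \<open>y\<close> that misses \<open>z\<close>.\<close>

lemma dependent_tripleI:
  assumes "{x, y, z} \<subseteq> U" "z \<noteq> x" "z \<noteq> y"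
    "\<And>F. F \<in> covering_lattice U \<C> \<Longrightarrow> x \<in> F \<Longrightarrow> y \<in> F \<Longrightarrow> z \<in> F"
  shows "\<not> partial_transversal U \<C> {x, y, z}"
proof
  assume "partial_transversal U \<C> {x, y, z}"
  then have "partial_transversal U \<C> (insert z {x, y})" by (simp add: insert_commute)
  moreover have "insert z {x, y} \<subseteq> U" "z \<notin> {x, y}" using assms by auto
  ultimately obtain F where "F \<in> covering_lattice U \<C>" "{x, y} \<subseteq> F" "z \<notin> F"
    unfolding covering_lattice_def
    using flat_separates_indep[of U "partial_transversal U \<C>" z "{x, y}"]
      finite_ground partial_transversal_empty by metis
  with assms(4) show False by simp
qed

text \<open>In a transversal through \<open>u\<close> one can exchange \<open>u\<close> for one of \<open>x\<close> and \<open>y\<close>: the sets of \<open>\<C>({x})\<close>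
  cannot represent all three elements.\<close>

lemma flat_contains:
  assumes F: "F \<in> covering_lattice U \<C>" and xy: "x \<in> F" "y \<in> F" "x \<noteq> y" and u: "u \<in> U"
    and two: "card (meeting \<C> {x}) = 2"
    and sub: "meeting \<C> {y} \<subseteq> meeting \<C> {x}" "meeting \<C> {u} \<subseteq> meeting \<C> {x}"
  shows "u \<in> F"
proof (rule ccontr)
  assume uF: "u \<notin> F"
  let ?P = "partial_transversal U \<C>"
  have FU: "F \<subseteq> U" and closed: "matroid_closure U ?P F = F"
    using F by (auto simp: covering_lattice_def matroid_flats_def)
  have fF: "finite F" using FU finite_ground finite_subset by blast
  \<comment> \<open>Trading independent sets for equally large ones inside \<open>F\<close> shows
    that adding \<open>u\<close> does not raise the rank of \<open>F\<close>.\<close>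
  have "\<exists>J. J \<subseteq> F \<and> ?P J \<and> card J = card I" if I: "I \<subseteq> insert u F" "?P I" for I
  proof (cases "u \<in> I")
    case False
    then show ?thesis using I by blast
  next
    case True
    have fI: "finite I" using I fF by (meson finite_insert finite_subset)
    obtain \<phi> where \<phi>: "inj_on \<phi> I" "\<And>e. e \<in> I \<Longrightarrow> \<phi> e \<in> meeting \<C> {e}"
      using I(2) by (auto simp: partial_transversal_def meeting_singleton)
    have repl: "\<exists>J. J \<subseteq> F \<and> ?P J \<and> card J = card I"
      if w: "w \<in> F" "w \<notin> I" and \<psi>: "inj_on \<psi> (insert w (I - {u}))"
        "\<And>e. e \<in> insert w (I - {u}) \<Longrightarrow> \<psi> e \<in> meeting \<C> {e}" for w \<psi>
    proof (intro exI conjI)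
      show "insert w (I - {u}) \<subseteq> F" using w I by auto
      then show "?P (insert w (I - {u}))"
        unfolding partial_transversal_def
        using \<psi> FU by (intro conjI exI[of _ \<psi>]) (auto simp: meeting_singleton)
      show "card (insert w (I - {u})) = card I"
        using w True fI card_Suc_Diff1[of I u] by simp
    qed
    have \<phi>u: "\<phi> u \<in> meeting \<C> {x}" using \<phi>(2)[OF True] sub by blast
    show ?thesis
    proof (cases "x \<in> I")
      case False
      \<comment> \<open>\<open>x\<close> inherits the representative of \<open>u\<close>, which
        contains \<open>x\<close> because of \<open>sub\<close>.\<close>
      show ?thesis
        using \<phi> \<phi>u xy False True
        by (intro repl[of x "\<phi>(x := \<phi> u)"]) (auto simp: inj_on_def)
    next
      case x: True
      have ux: "u \<noteq> x" using uF xy by blast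
      \<comment> \<open>Now \<open>u\<close> and \<open>x\<close> use up both members through
        \<open>x\<close>, so nothing is left for \<open>y\<close>, and \<open>y\<close> can replace
        \<open>u\<close>.\<close>
      have "\<phi> u \<noteq> \<phi> x" using \<phi>(1) True x ux by (auto simp: inj_on_def)
      then have "card {\<phi> u, \<phi> x} = 2" by simp
      then have eq: "meeting \<C> {x} = {\<phi> u, \<phi> x}"
        using two \<phi>(2)[OF x] \<phi>u finite_meeting card_subset_eq[of "meeting \<C> {x}" "{\<phi> u, \<phi> x}"] by auto
      have yI: "y \<notin> I"
      proof
        assume y: "y \<in> I"
        then have "\<phi> y \<in> {\<phi> u, \<phi> x}" using \<phi>(2) sub eq by blast
        then show False using \<phi>(1) y x True xy uF by (auto simp: inj_on_def)
      qed
      have "y \<in> U" using xy FU by blast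
      then obtain A where A: "A \<in> meeting \<C> {y}" using meeting_nonempty by blast
      then have "A = \<phi> u \<or> A = \<phi> x" using sub eq by auto
      \<comment> \<open>\<open>y\<close> may need the member that represents \<open>x\<close>; since
        \<open>x\<close> lies in both, it moves to the other one, \<open>B\<close>.\<close>
      then obtain B where B: "{A, B} = {\<phi> u, \<phi> x}" "A \<noteq> B"
        using \<open>\<phi> u \<noteq> \<phi> x\<close> by (metis insert_commute)
      have other: "\<phi> e \<noteq> A \<and> \<phi> e \<noteq> B" if "e \<in> I" "e \<noteq> u" "e \<noteq> x" for e
      proof -
        have "\<phi> e \<notin> {\<phi> u, \<phi> x}" using inj_onD[OF \<phi>(1)] that True x by auto
        then show ?thesis using B(1) by blast
      qed
      have Bx: "B \<in> meeting \<C> {x}" using eq B by blast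
      show ?thesis
      proof (rule repl[of y "\<phi>(x := B, y := A)"])
        show "inj_on (\<phi>(x := B, y := A)) (insert y (I - {u}))"
          using other B(2) \<phi>(1) yI by (auto simp: inj_on_def)
      qed (use xy yI A Bx \<phi> in auto)
    qed
  qed
  then have "card I \<le> matroid_rank ?P F" if "I \<subseteq> insert u F" "?P I" for I
    using that card_le_matroid_rank[of F _ ?P] fF by metis
  then have "matroid_rank ?P (insert u F) \<le> matroid_rank ?P F"
    using fF partial_transversal_empty by (intro matroid_rank_leI) auto
  moreover have "matroid_rank ?P F \<le> matroid_rank ?P (insert u F)"
    using fF by (intro matroid_rank_mono) (auto simp: partial_transversal_empty)
  ultimately have "u \<in> matroid_closure U ?P F"
    using u by (simp add: matroid_closure_def)
  with closed uF show False by blast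
qed

end

section \<open>Coordinatization of the ground set\<close>

locale coordinatized_covering =
  simple_covering U \<C> + vector_space scale
  for U :: "'a set" and \<C> :: "'a set set" and scale :: "'k::field \<Rightarrow> 'v::ab_group_add \<Rightarrow> 'v" +
  fixes f :: "'a set \<Rightarrow> 'v set"
  assumes bij: "bij_betw f (covering_lattice U \<C>) (subspace_lattice scale)"
    and iso: "\<And>X Y. X \<in> covering_lattice U \<C> \<Longrightarrow> Y \<in> covering_lattice U \<C> \<Longrightarrow>
                X \<subseteq> Y \<longleftrightarrow> f X \<subseteq> f Y"
begin

text \<open>Homogeneous coordinates: nonzero vectors name elements of \<open>U\<close>, and
  proportional vectors name the same one. For \<open>v = 0\<close> no such \<open>x\<close> exists
  and the value is arbitrary, hence the recurring condition \<open>v \<noteq> 0\<close>.\<close>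

definition point :: "'v \<Rightarrow> 'a" where
  "point v = (SOME x. x \<in> U \<and> f {x} = span {v})"

lemma subspace_flat: "F \<in> covering_lattice U \<C> \<Longrightarrow> subspace (f F)"
  using bij by (auto simp: bij_betw_def subspace_lattice_def)

lemma flat_of_subspace:
  assumes "subspace S"
  obtains F where "F \<in> covering_lattice U \<C>" "f F = S"
proof -
  have "S \<in> f ` covering_lattice U \<C>"
    using assms bij by (simp add: bij_betw_def subspace_lattice_def)
  then show ?thesis using that by (elim imageE) simp
qed

section \<open>Dictionary between elements of the ground set and vectors\<close>

lemma f_empty: "f {} = {0}"
proof -
  obtain F where F: "F \<in> covering_lattice U \<C>" "f F = {0}"
    using flat_of_subspace[OF subspace_single_0] .
  then have "f {} \<subseteq> {0}" using iso[OF empty_flat F(1)] by simp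
  moreover have "0 \<in> f {}" using subspace_flat[OF empty_flat] subspace_0 by blast
  ultimately show ?thesis by blast
qed

lemma f_singleton:
  assumes "x \<in> U"
  shows "\<exists>v. v \<noteq> 0 \<and> v \<in> f {x}"
proof -
  have "\<not> f {x} \<subseteq> f {}" using iso[OF singleton_flat[OF assms] empty_flat] by simp
  then show ?thesis using f_empty by auto
qed

lemma span_singleton_eq:
  assumes "w \<in> span {v}" "w \<noteq> 0"
  shows "span {w} = span {v}"
proof -
  obtain c where c: "w = scale c v" using assms by (auto simp: span_singleton)
  then have "c \<noteq> 0" using assms by auto
  then have "v = scale (inverse c) w" unfolding c by simp
  then have "v \<in> span {w}" by (metis span_base span_scale singletonI)
  with assms(1) show ?thesis by (simp add: span_eq)
qed

text \<open>Pick any \<open>x\<close> in the flat that corresponds to \<open>span {v}\<close>. The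
  image of \<open>{x}\<close> is a nonzero subspace of this one-dimensional space, hence all of
  it.\<close>

lemma point:
  assumes "v \<noteq> 0"
  shows "point v \<in> U" "f {point v} = span {v}"
proof -
  obtain F where F: "F \<in> covering_lattice U \<C>" "f F = span {v}"
    using flat_of_subspace[OF subspace_span] .
  have "v \<in> f F" using F by (simp add: span_base)
  then have "F \<noteq> {}" using f_empty assms by auto
  then obtain x where x: "x \<in> F" by blast
  then have xU: "x \<in> U" using F by (auto simp: covering_lattice_def matroid_flats_def)
  obtain w where w: "w \<noteq> 0" "w \<in> f {x}" using f_singleton[OF xU] by blast
  have le: "f {x} \<subseteq> span {v}" using iso[OF singleton_flat[OF xU] F(1)] x F by simp
  then have "span {w} = span {v}" using w by (intro span_singleton_eq) auto
  moreover have "span {w} \<subseteq> f {x}"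
    using w subspace_flat[OF singleton_flat[OF xU]] by (simp add: span_minimal)
  ultimately have "f {x} = span {v}" using le by simp
  then have "point v \<in> U \<and> f {point v} = span {v}"
    unfolding point_def using xU by (intro someI[of "\<lambda>x. x \<in> U \<and> f {x} = span {v}" x]) simp
  then show "point v \<in> U" "f {point v} = span {v}" by blast+
qed

text \<open>Turns incidence of points and flats into linear algebra, by applying \<open>iso\<close>
  to the flat \<open>{point v}\<close>.\<close>

lemma point_in_flat_iff:
  assumes "F \<in> covering_lattice U \<C>" "v \<noteq> 0"
  shows "point v \<in> F \<longleftrightarrow> v \<in> f F"
proof -
  have "point v \<in> F \<longleftrightarrow> span {v} \<subseteq> f F"
    using iso[OF singleton_flat assms(1)] point[OF assms(2)] by simp
  also have "\<dots> \<longleftrightarrow> v \<in> f F"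
    using subspace_flat[OF assms(1)] span_base[of v "{v}"] span_minimal[of "{v}" "f F"] by auto
  finally show ?thesis .
qed

lemma point_eq_iff:
  assumes "v \<noteq> 0" "w \<noteq> 0"
  shows "point v = point w \<longleftrightarrow> v \<in> span {w}"
  using point_in_flat_iff[OF singleton_flat[OF point(1)[OF assms(2)]] assms(1)] point(2)[OF assms(2)]
  by simp

lemma point_surj:
  assumes "x \<in> U"
  obtains v where "v \<noteq> 0" "x = point v"
proof -
  obtain v where v: "v \<noteq> 0" "v \<in> f {x}" using f_singleton[OF assms] by blast
  then have "point v \<in> {x}" using point_in_flat_iff[OF singleton_flat[OF assms]] by blast
  with v that show ?thesis by blast
qed

section \<open>Collinear points\<close>

text \<open>A flat through the first two points corresponds to a subspace containing
  \<open>a\<close> and \<open>b\<close>, hence \<open>c\<close>. So the triple is dependent and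
  \<open>dependent_triple\<close> applies.\<close>

lemma collinear_points:
  assumes "a \<noteq> 0" "b \<noteq> 0" "c \<noteq> 0" "c \<in> span {a, b}" "point a \<noteq> point b" "point a \<noteq> point c" "point b \<noteq> point c"
  obtains t where "t \<in> {point a, point b, point c}" "card (meeting \<C> {t}) = 2"
    "\<And>s. s \<in> {point a, point b, point c} \<Longrightarrow> meeting \<C> {s} \<subseteq> meeting \<C> {t}"
proof -
  have "point c \<in> F" if "F \<in> covering_lattice U \<C>" "point a \<in> F" "point b \<in> F" for F
  proof -
    have "{a, b} \<subseteq> f F" using that assms point_in_flat_iff by blast
    then have "c \<in> f F" using assms(4) span_minimal[OF _ subspace_flat[OF that(1)]] by blast
    then show ?thesis using point_in_flat_iff that assms by blast
  qed
  then have dep: "\<not> partial_transversal U \<C> {point a, point b, point c}"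
    using assms point(1) by (intro dependent_tripleI) auto
  have "{point a, point b, point c} \<subseteq> U" using assms point(1) by simp
  then show ?thesis
    by (rule dependent_triple[OF _ assms(5-7) dep]) (rule that)
qed

text \<open>The vector \<open>a + b\<close> supplies a third point on the line through the other
  two, over every field, the two-element one included.\<close>

lemma points_of_sum:
  assumes "a \<noteq> 0" "b \<notin> span {a}"
  shows "b \<noteq> 0" "a + b \<noteq> 0" "point a \<noteq> point b" "point a \<noteq> point (a + b)" "point b \<noteq> point (a + b)"
proof -
  show b: "b \<noteq> 0" using assms span_zero by metis
  have ab: "a + b \<notin> span {a}"
    using assms span_add_eq[of a "{a}" b] span_base[of a "{a}"] by blast
  then show ab0: "a + b \<noteq> 0" using span_zero by metis
  show "point a \<noteq> point b" using assms b point_eq_iff by metis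
  show "point a \<noteq> point (a + b)" using assms ab ab0 point_eq_iff by metis
  have "a \<notin> span {b}"
    using assms span_singleton_eq[of a b] span_base[of b "{b}"] by blast
  then have "a + b \<notin> span {b}"
    using span_add_eq2[of b "{b}" a] span_base[of b "{b}"] by blast
  then show "point b \<noteq> point (a + b)" using b ab0 point_eq_iff by metis
qed

lemma sum_line:
  assumes "a \<noteq> 0" "b \<notin> span {a}"
  obtains t where "t \<in> {point a, point b, point (a + b)}" "card (meeting \<C> {t}) = 2"
    "\<And>s. s \<in> {point a, point b, point (a + b)} \<Longrightarrow> meeting \<C> {s} \<subseteq> meeting \<C> {t}"
proof -
  note ps = points_of_sum[OF assms]
  have "a + b \<in> span {a, b}" by (simp add: span_add span_base)
  then show ?thesis
    by (rule collinear_points[OF assms(1) ps(1,2) _ ps(3-5)]) (rule that)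
qed

text \<open>A vector \<open>c\<close> outside would give a second line, through the special point
  \<open>t\<close> of the first one. The special point \<open>s\<close> of the second line has the
  same two members as \<open>t\<close>, so \<open>point c\<close> lies in no others, and
  \<open>flat_contains\<close> forces it onto the first line.\<close>

lemma no_three_independent:
  assumes "a \<noteq> 0" "b \<notin> span {a}"
  shows "c \<in> span {a, b}"
proof (rule ccontr)
  assume c: "c \<notin> span {a, b}"
  note ps = points_of_sum[OF assms]
  obtain t where t: "t \<in> {point a, point b, point (a + b)}" "card (meeting \<C> {t}) = 2"
    "\<And>s. s \<in> {point a, point b, point (a + b)} \<Longrightarrow> meeting \<C> {s} \<subseteq> meeting \<C> {t}"
    by (rule sum_line[OF assms]) (rule that)
  have ab: "{a, b, a + b} \<subseteq> span {a, b}" by (simp add: span_add span_base)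
  obtain d where d: "d \<in> {a, b, a + b}" "t = point d" using t(1) by blast
  \<comment> \<open>\<open>flat_contains\<close> requires a second point of the first line besides
    \<open>t\<close>.\<close>
  obtain e where e: "e \<in> {a, b, a + b}" "t \<noteq> point e"
    using ps(3) by (metis insertCI)
  have d0: "d \<noteq> 0" and e0: "e \<noteq> 0" using d(1) e(1) assms(1) ps(1,2) by auto
  have "span {d} \<subseteq> span {a, b}" using d ab by (intro span_minimal) auto
  then have cd: "c \<notin> span {d}" using c by blast
  obtain s where s: "s \<in> {point d, point c, point (d + c)}" "card (meeting \<C> {s}) = 2"
    "\<And>r. r \<in> {point d, point c, point (d + c)} \<Longrightarrow> meeting \<C> {r} \<subseteq> meeting \<C> {s}"
    by (rule sum_line[OF d0 cd]) (rule that)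
  \<comment> \<open>The left side is contained in the right one, and both have two elements.\<close>
  have "meeting \<C> {t} = meeting \<C> {s}"
    using s t d by (intro card_subset_eq finite_meeting) auto
  then have tc: "meeting \<C> {point c} \<subseteq> meeting \<C> {t}" using s(3) by auto
  have c0: "c \<noteq> 0" using c span_zero by metis
  obtain F where F: "F \<in> covering_lattice U \<C>" "f F = span {a, b}"
    using flat_of_subspace[OF subspace_span] .
  have tF: "t \<in> F" and eF: "point e \<in> F"
    using point_in_flat_iff[OF F(1)] d e ab F d0 e0 by auto
  have "meeting \<C> {point e} \<subseteq> meeting \<C> {t}" using t(3) e by auto
  then have "point c \<in> F"
    by (rule flat_contains[OF F(1) tF eF e(2) point(1)[OF c0] t(2) _ tc])
  then show False using point_in_flat_iff[OF F(1) c0] F c by blast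
qed

section \<open>Size of the ground set and the family of the sets
  \<open>E_set U \<C> x\<close>\<close>

text \<open>Since \<open>a\<close> and \<open>b\<close> span \<open>V\<close>, the ground set is a
  projective line: the affine points with vectors \<open>b + scale c a\<close>, one for each scalar
  \<open>c\<close>, and \<open>point a\<close> at infinity.\<close>

lemma card_ground:
  fixes a b :: 'v
  assumes "a \<noteq> 0" "b \<notin> span {a}" "finite (UNIV :: 'k set)"
  shows "card U = CARD('k) + 1"
proof -
  let ?g = "\<lambda>c. b + scale c a"
  have gnot: "?g c \<notin> span {a}" for c
  proof
    assume "?g c \<in> span {a}"
    moreover have "scale c a \<in> span {a}" by (simp add: span_scale span_base)
    ultimately have "?g c - scale c a \<in> span {a}" by (rule span_diff)
    with assms show False by simp
  qed
  have g0: "?g c \<noteq> 0" for c using gnot[of c] span_zero by metis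
  have inj: "inj (\<lambda>c. point (?g c))"
  proof (rule injI)
    fix c c' assume "point (?g c) = point (?g c')"
    then obtain r where r: "?g c = scale r (?g c')"
      using point_eq_iff g0 by (auto simp: span_singleton)
    \<comment> \<open>For \<open>r \<noteq> 1\<close> this would make \<open>b\<close> a multiple of
      \<open>a\<close>; for \<open>r = 1\<close> it leaves \<open>c' - c = 0\<close>.\<close>
    have 1: "scale (1 - r) b = scale (r * c' - c) a"
      using r by (simp add: algebra_simps)
    have "r = 1"
    proof (rule ccontr)
      assume "r \<noteq> 1"
      then have "b = scale (inverse (1 - r)) (scale (1 - r) b)" by simp
      then have "b \<in> span {a}" unfolding 1 by (metis span_base span_scale singletonI)
      with assms show False by blast
    qed
    with 1 assms show "c = c'" by simp
  qed
  have "point a \<notin> range (\<lambda>c. point (?g c))"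
    using point_eq_iff[OF assms(1) g0] point_eq_iff[OF g0 assms(1)] gnot by (auto simp: eq_commute)
  moreover have "U = insert (point a) (range (\<lambda>c. point (?g c)))"
  proof (intro equalityI subsetI)
    fix x assume "x \<in> U"
    then obtain v where v: "v \<noteq> 0" "x = point v" by (rule point_surj)
    have "v \<in> span {b, a}" using no_three_independent[OF assms(1,2)] by (simp add: insert_commute)
    then obtain r where "v - scale r b \<in> span {a}" by (auto simp: span_breakdown_eq)
    then obtain s where "v - scale r b = scale s a" by (auto simp: span_singleton)
    then have rs: "v = scale r b + scale s a" by (simp add: algebra_simps)
    show "x \<in> insert (point a) (range (\<lambda>c. point (?g c)))"
    proof (cases "r = 0")
      case True
      then have "v \<in> span {a}" using rs by (simp add: span_scale span_base)
      then show ?thesis using point_eq_iff[OF v(1) assms(1)] v(2) by simp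
    next
      case False
      \<comment> \<open>Normalize the coefficient of \<open>b\<close> to one.\<close>
      then have "v = scale r (?g (s / r))" using rs by (simp add: algebra_simps)
      then have "v \<in> span {?g (s / r)}" by (metis span_base span_scale singletonI)
      then have "x = point (?g (s / r))" using point_eq_iff[OF v(1) g0] v(2) by simp
      then show ?thesis by simp
    qed
  qed (use point(1) assms(1) g0 in auto)
  ultimately have "card U = Suc (card (range (\<lambda>c. point (?g c))))"
    using assms(3) by (metis card_insert_disjoint finite_imageI)
  then show ?thesis using inj by (simp add: card_image)
qed

text \<open>All points are collinear, so \<open>t\<close> and any other \<open>y\<close> extend to a
  collinear triple. Its special point has the same two members as \<open>t\<close>, and these
  contain all members through \<open>y\<close>.\<close>

lemma E_family_eq:
  assumes "a \<noteq> 0" "b \<notin> span {a}"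
  shows "E_family U \<C> = {U}"
proof -
  note ps = points_of_sum[OF assms]
  have coll: "v \<in> span {u, w}" if "u \<noteq> 0" "w \<noteq> 0" "point u \<noteq> point w" for u v w
    using no_three_independent[of u w v] point_eq_iff[of w u] that by metis
  have "meeting \<C> {y} \<subseteq> meeting \<C> {t}" if t: "t \<in> U" "card (meeting \<C> {t}) = 2" and y: "y \<in> U" for t y
  proof (cases "y = t")
    case False
    \<comment> \<open>The three distinct points of \<open>points_of_sum\<close> cannot all be among
      \<open>t\<close> and \<open>y\<close>.\<close>
    obtain z where z: "z \<in> U" "z \<noteq> t" "z \<noteq> y"
      using ps assms(1) point(1) by metis
    obtain u v w where uvw: "u \<noteq> 0" "v \<noteq> 0" "w \<noteq> 0" "t = point u" "y = point v" "z = point w"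
      using point_surj[OF t(1)] point_surj[OF y] point_surj[OF z(1)] by metis
    have neq: "point u \<noteq> point v" "point u \<noteq> point w" "point v \<noteq> point w"
      using False z uvw by auto
    obtain s where s: "card (meeting \<C> {s}) = 2"
      "\<And>r. r \<in> {t, y, z} \<Longrightarrow> meeting \<C> {r} \<subseteq> meeting \<C> {s}"
      using collinear_points[OF uvw(1-3) coll[OF uvw(1,2) neq(1)] neq] uvw(4-6) by metis
    have "meeting \<C> {t} = meeting \<C> {s}"
      using s t by (intro card_subset_eq finite_meeting) auto
    then show ?thesis using s(2) by auto
  qed simp
  then have "E_set U \<C> t = U" if "t \<in> U" "card (meeting \<C> {t}) = 2" for t
    using that by (auto simp: E_set_def)
  \<comment> \<open>At least one such element is required for the family to be nonempty.\<close>
  moreover obtain t where "t \<in> U" "card (meeting \<C> {t}) = 2"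
    by (rule sum_line[OF assms]) (use point(1) ps assms(1) in auto)
  ultimately show ?thesis unfolding E_family_def by auto
qed

end

theorem theorem4p13:
  fixes U :: "'a set" and \<C> :: "'a set set"
    and scale :: "'k::{field,finite} \<Rightarrow> 'v::ab_group_add \<Rightarrow> 'v" and Basis :: "'v set"
    and m n q k :: nat
  assumes "finite U" and "card U = m"
    and "covering U \<C>"
    and "\<not> (\<exists>u\<in>U. \<exists>v\<in>U. u \<noteq> v \<and> meeting \<C> {u} = meeting \<C> {v} \<and> card (meeting \<C> {u}) = 1)"
    and "CARD('k) = q"
    and "finite_dimensional_vector_space scale Basis"
    and "vector_space.dim scale (UNIV :: 'v set) = n"
    and "k = card (E_family U \<C>)"
    and "inclusion_isomorphic (covering_lattice U \<C>) (subspace_lattice scale)"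
  shows "n \<le> 2 \<and> (n = 2 \<longrightarrow> m = q + 1 \<and> k = 1)"
proof (cases "n < 2")
  case False
  interpret fd: finite_dimensional_vector_space scale Basis by fact
  obtain f where f: "bij_betw f (covering_lattice U \<C>) (subspace_lattice scale)"
    "\<forall>X\<in>covering_lattice U \<C>. \<forall>Y\<in>covering_lattice U \<C>. X \<subseteq> Y \<longleftrightarrow> f X \<subseteq> f Y"
    using assms(9) unfolding inclusion_isomorphic_def by blast
  interpret coordinatized_covering U \<C> scale f
    by unfold_locales (use assms(1,3,4) f in blast)+
  have n: "card Basis = n" using fd.dim_UNIV assms(7) by simp
  \<comment> \<open>Dimension at least two provides the independent pair from which all of the
    geometry starts.\<close>
  then obtain a b where ab: "a \<in> Basis" "b \<in> Basis" "a \<noteq> b"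
    using False by (metis card_le_Suc0_iff_eq fd.finite_Basis not_less_eq_eq numeral_2_eq_2 leI less_Suc_eq_le)
  have a: "a \<noteq> 0" using ab fd.independent_Basis fd.dependent_zero by blast
  have nb: "b \<notin> fd.span (Basis - {b})" using ab fd.independent_Basis fd.dependent_def by blast
  have b: "b \<notin> fd.span {a}"
    using nb ab fd.span_mono[of "{a}" "Basis - {b}"] by blast
  \<comment> \<open>A third basis vector would lie in the span of \<open>a\<close> and
    \<open>b\<close>, against independence.\<close>
  have "Basis \<subseteq> {a, b}"
  proof
    fix c assume c: "c \<in> Basis"
    show "c \<in> {a, b}"
    proof (rule ccontr)
      assume "c \<notin> {a, b}"
      then have "fd.span {a, b} \<subseteq> fd.span (Basis - {c})" using ab by (intro fd.span_mono) blast
      then show False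
        using no_three_independent[OF a b, of c] c fd.independent_Basis fd.dependent_def by blast
    qed
  qed
  then have "n \<le> card {a, b}" using n by (metis card_mono finite.emptyI finite_insert)
  then have "n \<le> 2" using ab by simp
  then show ?thesis
    using card_ground[OF a b] E_family_eq[OF a b] assms(2,5,8) by simp
qed simp

end
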